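(* Let $(\mathcal{X},d)$ be a metric space, let $\mathcal{F}$ be a symmetric subset of the set $\mathrm{Lip}_1$ of $1$-Lipschitz real-valued functions on $\mathcal{X}$, let $P^*$ be a probability measure on $\mathcal{X}$, and let $S=(x_1,\dots,x_n)\in\mathcal{X}^n$ be an i.i.d. sample from $P^*$, with empirical distribution $P^*_n$. Let $\mathcal{Z}=[0,1]^{d_{\mathcal{Z}}}$ (with the Euclidean metric), let $P_{\mathcal{Z}}$ be a probability measure on $\mathcal{Z}$, and let $g^*:\mathcal{Z}\to\mathcal{X}$ be such that $P^*=g^*\sharp P_{\mathcal{Z}}$. Let $\mathcal{G}$ be a set of functions $g:\mathcal{Z}\to\mathcal{X}$, each inducing the probability measure $P^g=g\sharp P_{\mathcal{Z}}$ on $\mathcal{X}$. Assume that, for some real number $K>0$, every function in $\mathcal{G}\cup\{g^*\}$ is $K$-Lipschitz. Let $\pi$ be a (prior) probability measure on $\mathcal{G}$, not depending on $S$, and let $\lambda>0$ and $\delta\in(0,1)$ be real numbers. Let $\mathcal{W}_{\mathcal{F}}(P^*_n,P^g)=\mathbb{E}_{S_g}[d_{\mathcal{F}}(P^*_n,P^g_n)]$. Then: (i) For any probability measure $\rho$ on $\mathcal{G}$ such that $\rho\ll\pi$ and $\pi\ll\rho$, with probability at least $1-\delta$ over the random draw of $S\sim(P^* )^{\otimes n}$, $$\mathbb{E}_{g\sim\rho}\,\mathbb{E}_{S}\big[\mathcal{W}_{\mathcal{F}}(P^*_n,P^g)\big]-\mathbb{E}_{g\sim\rho}\big[\mathcal{W}_{\mathcal{F}}(P^*_n,P^g)\big]\le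 \frac1\lambda\Big[\mathrm{KL}(\rho\,\|\,\pi)+\log\frac1\delta\Big]+\frac{\lambda K^2 d_{\mathcal{Z}}}{4n}.$$ (ii) For any probability measure $\rho$ on $\mathcal{G}$ such that $\rho\ll\pi$ and $\pi\ll\rho$, with probability at least $1-\delta$ over the random draw of $S\sim(P^* )^{\otimes n}$ and $g\sim\rho$, $$\mathbb{E}_{S}\big[\mathcal{W}_{\mathcal{F}}(P^*_n,P^g)\big]-\mathcal{W}_{\mathcal{F}}(P^*_n,P^g)\le \frac1\lambda\Big[\log\frac{d\rho}{d\pi}(g)+\log\frac1\delta\Big]+\frac{\lambda K^2 d_{\mathcal{Z}}}{4n}.$$
   Context: A set $\mathcal{F}$ of real-valued functions is symmetric if $f\in\mathcal{F}$ implies $-f\in\mathcal{F}$. For probability measures $P,Q$ on $\mathcal{X}$, the integral probability metric induced by $\mathcal{F}$ is $d_{\mathcal{F}}(P,Q)=\sup_{f\in\mathcal{F}}\left|\int f\,dP-\int f\,dQ\right|$. The pushforward measure is $g\sharp P_{\mathcal{Z}}(A)=P_{\mathcal{Z}}(g^{-1}(A))$. $d_{\mathcal{Z}}$ is a positive integer. The empirical distribution of $S=(x_1,\dots,x_n)$ is $P^*_n=\frac1n\sum_{i=1}^n\delta_{x_i}$. For $g\in\mathcal{G}$, $S_g=(\hat x_1,\dots,\hat x_n)\sim(P^g)^{\otimes n}$ is an i.i.d. sample of the same size $n$, independent of $S$, with empirical distribution $P^g_n=\frac1n\sum_{i=1}^n\delta_{\hat x_i}$. The empirical risk $\mathcal{W}_{\mathcal{F}}(P^*_n,P^g)=\mathbb{E}_{S_g}[d_{\mathcal{F}}(P^*_n,P^g_n)]$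 is an expectation over $S_g$ only, hence a function of $S$ and $g$. $\mathbb{E}_S$ denotes expectation over $S\sim(P^* )^{\otimes n}$. $\mathrm{KL}(\rho\,\|\,\pi)=\mathbb{E}_{g\sim\rho}[\log\frac{d\rho}{d\pi}(g)]$ is the Kullback–Leibler divergence, $\ll$ denotes absolute continuity, and $\frac{d\rho}{d\pi}$ is the Radon–Nikodym derivative. Convention: $\mathcal{G}$ carries a $\sigma$-algebra, and all quantities whose expectation or probability is taken are understood to be (jointly) measurable in $S$, $S_g$, $g$, with $g\mapsto P^g$ a Markov kernel. *)

theory Defs
  imports "HOL-Probability.Probability"
begin

definition symmetric_class :: "('x \<Rightarrow> real) set \<Rightarrow> bool" where
  "symmetric_class F \<longleftrightarrow> (\<forall>f\<in>F. (\<lambda>x. - f x) \<in> F)"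

definition Lip1 :: "('x::metric_space \<Rightarrow> real) set" where
  "Lip1 = {f. 1-lipschitz_on UNIV f}"

definition unit_cube :: "(real ^ 'd) set" where
  "unit_cube = {z. \<forall>i. 0 \<le> z $ i \<and> z $ i \<le> 1}"

text \<open>The supremum is taken in the extended nonnegative reals, so that it is 0 for an empty class
  and infinite for an unbounded family. The integrals are Bochner integrals, so the definition is
  meaningful when every function of the class is integrable with respect to both measures; this
  is always the case for empirical measures and continuous functions.\<close>

definition ipm :: "('x \<Rightarrow> real) set \<Rightarrow> 'x measure \<Rightarrow> 'x measure \<Rightarrow> ennreal" where
  "ipm F P Q = (SUP f\<in>F. ennreal \<bar>(\<integral>x. f x \<partial>P) - (\<integral>x. f x \<partial>Q)\<bar>)"

text \<open>A sample of size \<open>n\<close> is a function whose values at \<open>0, \<dots>, n - 1\<close> are the sample points.\<close>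

definition empirical :: "nat \<Rightarrow> (nat \<Rightarrow> 'x::topological_space) \<Rightarrow> 'x measure" where
  "empirical n x =
     measure_of UNIV (sets borel) (\<lambda>A. ennreal (1 / real n) * (\<Sum>i<n. emeasure (return borel (x i)) A))"

abbreviation iid_sample :: "nat \<Rightarrow> 'x measure \<Rightarrow> (nat \<Rightarrow> 'x) measure" where
  "iid_sample n P \<equiv> (\<Pi>\<^sub>M i\<in>{..<n}. P)"

text \<open>The empirical risk, as a function of the observed sample \<open>x\<close> and of the model measure \<open>P\<close>.
  The conversion to real numbers loses nothing for a class of 1-Lipschitz functions, since the
  distance of two empirical measures is then finite (\<open>ipm_empirical_finite\<close> below).\<close>

definition empirical_risk ::
    "('x::topological_space \<Rightarrow> real) set \<Rightarrow> nat \<Rightarrow> (nat \<Rightarrow> 'x) \<Rightarrow> 'x measure \<Rightarrow> real" where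
  "empirical_risk F n x P = (\<integral>y. enn2real (ipm F (empirical n x) (empirical n y)) \<partial>iid_sample n P)"

text \<open>Note the order of arguments: the library's \<open>entropy_density b \<pi> \<rho>\<close> is the logarithm to base
  \<open>b\<close> of the density of \<open>\<rho>\<close> with respect to \<open>\<pi>\<close>. For probability measures with \<open>\<rho>\<close> absolutely
  continuous with respect to \<open>\<pi>\<close>, the negative part of this function is \<open>\<rho>\<close>-integrable, so if it
  is not integrable then its expectation is infinite, whereas the library's real-valued divergence
  would be 0.\<close>

definition KL :: "'a measure \<Rightarrow> 'a measure \<Rightarrow> ereal" where
  "KL \<rho> \<pi> = (if integrable \<rho> (entropy_density (exp 1) \<pi> \<rho>)
             then ereal (KL_divergence (exp 1) \<pi> \<rho>) else \<infinity>)"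

lemma space_empirical [simp]: "space (empirical n x) = UNIV"
  by (simp add: empirical_def space_measure_of_conv)

lemma sets_empirical [simp, measurable_cong]: "sets (empirical n x) = sets borel"
proof -
  have "sigma_sets UNIV (sets (borel :: 'a measure)) = sets borel"
    using sets.sigma_sets_eq[of "borel :: 'a measure"] by simp
  then show ?thesis
    by (simp add: empirical_def)
qed

lemma emeasure_empirical:
  assumes "A \<in> sets borel"
  shows "emeasure (empirical n x) A =
    ennreal (1 / real n) * (\<Sum>i<n. emeasure (return borel (x i)) A)"
proof (rule emeasure_measure_of[OF empirical_def])
  show "sets borel \<subseteq> Pow (UNIV :: 'a set)" by simp
  show "A \<in> sets (empirical n x)" using assms by simp
  show "positive (sets (empirical n x))
      (\<lambda>A. ennreal (1 / real n) * (\<Sum>i<n. emeasure (return borel (x i)) A))"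
    by (simp add: positive_def)
  show "countably_additive (sets (empirical n x))
      (\<lambda>A. ennreal (1 / real n) * (\<Sum>i<n. emeasure (return borel (x i)) A))"
  proof (rule countably_additiveI)
    fix B :: "nat \<Rightarrow> 'a set"
    assume B: "range B \<subseteq> sets (empirical n x)" "disjoint_family B"
    have "(\<Sum>k. \<Sum>i<n. emeasure (return borel (x i)) (B k))
        = (\<Sum>i<n. \<Sum>k. emeasure (return borel (x i)) (B k))"
      by (rule suminf_sum) auto
    also have "\<dots> = (\<Sum>i<n. emeasure (return borel (x i)) (\<Union>k. B k))"
      using B by (intro sum.cong refl suminf_emeasure) auto
    finally show "(\<Sum>k. ennreal (1 / real n) * (\<Sum>i<n. emeasure (return borel (x i)) (B k)))
        = ennreal (1 / real n) * (\<Sum>i<n. emeasure (return borel (x i)) (\<Union>k. B k))"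
      by simp
  qed
qed

lemma empirical_eq_distr:
  assumes "n > 0"
  shows "empirical n x = distr (uniform_count_measure {..<n}) borel x"
proof (rule measure_eqI)
  fix A :: "'a set"
  assume "A \<in> sets (empirical n x)"
  then have A: "A \<in> sets borel" by simp
  have "(\<Sum>i<n. emeasure (return borel (x i)) A) = (\<Sum>i<n. indicator A (x i))"
    using A by simp
  also have "\<dots> = (\<Sum>i\<in>{i\<in>{..<n}. x i \<in> A}. 1)"
    by (rule sum.mono_neutral_cong_right) (auto simp: indicator_def)
  also have "\<dots> = ennreal (real (card (x -` A \<inter> {..<n})))"
    by (simp add: ennreal_of_nat_eq_real_of_nat vimage_def Int_def conj_commute)
  finally show "emeasure (empirical n x) A
      = emeasure (distr (uniform_count_measure {..<n}) borel x) A"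
    using A assms
    by (simp add: emeasure_empirical emeasure_distr emeasure_uniform_count_measure
        space_uniform_count_measure sets_uniform_count_measure_count_space
        measurable_cong_sets[OF sets_uniform_count_measure_count_space refl]
        flip: ennreal_mult)
qed simp

lemma integral_empirical:
  fixes f :: "'x::topological_space \<Rightarrow> real"
  assumes "n > 0" "f \<in> borel_measurable borel"
  shows "(\<integral>z. f z \<partial>empirical n x) = (\<Sum>i<n. f (x i)) / real n"
proof -
  have "(\<integral>z. f z \<partial>empirical n x) = (\<integral>i. f (x i) \<partial>uniform_count_measure {..<n})"
    unfolding empirical_eq_distr[OF assms(1)]
    by (rule integral_distr[OF _ assms(2)])
      (simp add: measurable_cong_sets[OF sets_uniform_count_measure_count_space refl])
  then show ?thesis
    by (simp add: uniform_count_measure_def lebesgue_integral_point_measure_finite sum_divide_distrib)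
qed

lemma ipm_empirical_finite:
  fixes F :: "('x::metric_space \<Rightarrow> real) set"
  assumes "n > 0" "F \<subseteq> Lip1"
  shows "ipm F (empirical n x) (empirical n y) < \<infinity>"
proof -
  have "ipm F (empirical n x) (empirical n y) \<le> ennreal ((\<Sum>i<n. dist (x i) (y i)) / real n)"
    unfolding ipm_def
  proof (rule SUP_least)
    fix f assume "f \<in> F"
    with assms have lip: "1-lipschitz_on UNIV f" by (auto simp: Lip1_def)
    then have m: "f \<in> borel_measurable borel"
      by (intro borel_measurable_continuous_onI lipschitz_on_continuous_on)
    have "\<bar>(\<Sum>i<n. f (x i)) / real n - (\<Sum>i<n. f (y i)) / real n\<bar>
        = \<bar>\<Sum>i<n. f (x i) - f (y i)\<bar> / real n"
      by (simp add: sum_subtractf diff_divide_distrib[symmetric])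
    also have "\<dots> \<le> (\<Sum>i<n. \<bar>f (x i) - f (y i)\<bar>) / real n"
      by (intro divide_right_mono sum_abs) auto
    also have "\<dots> \<le> (\<Sum>i<n. dist (x i) (y i)) / real n"
      using lip by (intro divide_right_mono sum_mono)
        (auto simp: lipschitz_on_def dist_real_def)
    finally show "ennreal \<bar>(\<integral>z. f z \<partial>empirical n x) - (\<integral>z. f z \<partial>empirical n y)\<bar>
        \<le> ennreal ((\<Sum>i<n. dist (x i) (y i)) / real n)"
      using m assms(1) by (intro ennreal_leI) (simp add: integral_empirical)
  qed
  also have "\<dots> < \<infinity>" by simp
  finally show ?thesis .
qed

end

theory Submission
  imports Defs
begin

text \<open>For a fixed \<open>g\<close>, changing one of the \<open>n\<close> sample points changes the empirical risk by at most
  \<open>K sqrt d / n\<close>, since the sample lies in the \<open>K\<close>-Lipschitz image of the unit cube, whose diameter is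
  at most \<open>K sqrt d\<close>. The method of bounded differences (Hoeffding's lemma one coordinate at a time)
  bounds the exponential moment of the deviation of the risk below its mean. Weighting with the
  reciprocal density and integrating over \<open>g\<close> gives
  \<open>E\<^sub>S E\<^sub>\<rho> exp (l (E\<^sub>S W - W) - l\<^sup>2 K\<^sup>2 d / (8 n) - log (d\<rho>/d\<pi>)) \<le> 1\<close>. Markov's inequality on the
  product space yields (ii); Markov's inequality in \<open>S\<close> followed by Jensen's inequality in \<open>g\<close>
  yields (i). This route gives the constant \<open>8\<close> in place of \<open>4\<close>.\<close>

section \<open>The method of bounded differences\<close>

text \<open>Passing from \<open>x\<close> to \<open>y\<close> one coordinate at a time, each
  replacement costs at most \<open>c i\<close>. A function with bounded differences is therefore
  bounded, which supplies integrability in the exponential estimate below.\<close>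

lemma bounded_differences_oscillation:
  fixes f :: "('i \<Rightarrow> 'a) \<Rightarrow> real"
  assumes "finite I"
    and "\<And>i x a. i \<in> I \<Longrightarrow> x \<in> Pi\<^sub>E I S \<Longrightarrow> a \<in> S i \<Longrightarrow> \<bar>f (x(i := a)) - f x\<bar> \<le> c i"
    and "x \<in> Pi\<^sub>E I S" "y \<in> Pi\<^sub>E I S"
  shows "\<bar>f x - f y\<bar> \<le> (\<Sum>i\<in>I. c i)"
  using assms
proof (induction I arbitrary: f x y rule: finite_induct)
  case empty
  then show ?case by simp
next
  case (insert i J)
  \<comment> \<open>Resetting coordinate \<open>i\<close> to \<open>undefined\<close> puts the
    points into the extensional product over \<open>J\<close>; the induction hypothesis then applies
    to the section of \<open>f\<close> with coordinate \<open>i\<close> frozen at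
    \<open>x i\<close>.\<close>
  define x' where "x' = x(i := undefined)"
  define y' where "y' = y(i := undefined)"
  have x': "x' \<in> Pi\<^sub>E J S" and y': "y' \<in> Pi\<^sub>E J S"
    using insert.prems(2,3) insert.hyps(2) by (auto simp: x'_def y'_def PiE_iff extensional_def)
  have xi: "x i \<in> S i" "y i \<in> S i" using insert.prems(2,3) by auto
  have "\<bar>f (x'(i := x i)) - f (y'(i := x i))\<bar> \<le> (\<Sum>i\<in>J. c i)"
  proof (rule insert.IH[of "\<lambda>z. f (z(i := x i))", OF _ x' y'])
    fix j z a assume *: "j \<in> J" "z \<in> Pi\<^sub>E J S" "a \<in> S j"
    then have "z(i := x i) \<in> Pi\<^sub>E (insert i J) S" using xi by (auto simp: PiE_iff extensional_def)
    then have "\<bar>f ((z(i := x i))(j := a)) - f (z(i := x i))\<bar> \<le> c j"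
      by (rule insert.prems(1)[OF insertI2[OF *(1)] _ *(3)])
    moreover have "(z(j := a))(i := x i) = (z(i := x i))(j := a)"
      using *(1) insert.hyps(2) by (auto simp: fun_upd_twist)
    ultimately show "\<bar>f ((z(j := a))(i := x i)) - f (z(i := x i))\<bar> \<le> c j" by simp
  qed
  moreover have "x'(i := x i) = x" "y'(i := x i) = y(i := x i)" by (auto simp: x'_def y'_def)
  moreover have "\<bar>f (y(i := x i)) - f y\<bar> \<le> c i"
    using insert.prems(3) xi by (intro insert.prems(1)) auto
  ultimately show ?case using insert.hyps by simp
qed

text \<open>Induction on the coordinates. Averaging over coordinate \<open>i\<close> gives a
  function \<open>h\<close> of the others with the same mean and the same bounded differences, and f
  - E f splits into (f - h) + (h - E h). With the other coordinates fixed, Hoeffding's lemma bounds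
  the first summand's contribution by a factor exp(l^2 c_i^2 / 8); the induction hypothesis handles
  the second.\<close>

lemma bounded_differences_exp:
  fixes f :: "('i \<Rightarrow> 'a) \<Rightarrow> real"
  assumes M: "\<And>i. prob_space (M i)"
    and "finite I" "f \<in> borel_measurable (Pi\<^sub>M I M)"
    and "\<And>i x a. i \<in> I \<Longrightarrow> x \<in> space (Pi\<^sub>M I M) \<Longrightarrow> a \<in> space (M i) \<Longrightarrow>
            \<bar>f (x(i := a)) - f x\<bar> \<le> c i"
    and l: "l > 0"
  shows "(\<integral>\<^sup>+x. exp (l * (f x - (\<integral>y. f y \<partial>Pi\<^sub>M I M))) \<partial>Pi\<^sub>M I M)
           \<le> exp (l\<^sup>2 * (\<Sum>i\<in>I. (c i)\<^sup>2) / 8)"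
  using assms(2-4)
proof (induction I arbitrary: f rule: finite_induct)
  case empty
  interpret product_prob_space M
    using M by (simp add: product_prob_space_def product_prob_space_axioms_def product_sigma_finite_def
        prob_space_imp_sigma_finite)
  show ?case
    by (simp add: nn_integral_empty integral_empty PiM_empty nn_integral_count_space_finite
        lebesgue_integral_count_space_finite)
next
  case (insert i J)
  interpret Mi: prob_space "M i" by (rule M)
  interpret product_prob_space M
    using M by (simp add: product_prob_space_def product_prob_space_axioms_def product_sigma_finite_def
        prob_space_imp_sigma_finite)
  interpret J: prob_space "Pi\<^sub>M J M" by (rule prob_space_PiM) (rule M)
  interpret iJ: prob_space "Pi\<^sub>M (insert i J) M" by (rule prob_space_PiM) (rule M)
  note [measurable] = insert.prems(1)
  have upd: "x(i := y) \<in> space (Pi\<^sub>M (insert i J) M)"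
    if "x \<in> space (Pi\<^sub>M J M)" "y \<in> space (M i)" for x y
    using that by (auto simp: space_PiM PiE_iff extensional_def)
  \<comment> \<open>Any base point turns the oscillation bound into a global bound \<open>B\<close>,
    so \<open>f\<close> and all its sections are integrable.\<close>
  obtain x0 where x0: "x0 \<in> space (Pi\<^sub>M (insert i J) M)" using iJ.not_empty by blast
  define B where "B = \<bar>f x0\<bar> + (\<Sum>i\<in>insert i J. c i)"
  have B: "\<bar>f x\<bar> \<le> B" if "x \<in> space (Pi\<^sub>M (insert i J) M)" for x
  proof -
    have "\<bar>f x - f x0\<bar> \<le> (\<Sum>i\<in>insert i J. c i)"
      using insert.hyps(1) that x0 insert.prems(2)
      by (intro bounded_differences_oscillation[where S = "\<lambda>i. space (M i)"]) (auto simp: space_PiM)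
    then show ?thesis unfolding B_def by linarith
  qed
  have int_f: "integrable (Pi\<^sub>M (insert i J) M) f"
    using B by (intro iJ.integrable_const_bound[where B = B]) auto
  have sect [measurable]: "(\<lambda>y. f (x(i := y))) \<in> borel_measurable (M i)"
    if "x \<in> space (Pi\<^sub>M J M)" for x
    using that by measurable
  have int_sect: "integrable (M i) (\<lambda>y. f (x(i := y)))" if "x \<in> space (Pi\<^sub>M J M)" for x
    using B upd that by (intro Mi.integrable_const_bound[where B = B]) auto
  define h where "h x = (\<integral>y. f (x(i := y)) \<partial>M i)" for x
  have h [measurable]: "h \<in> borel_measurable (Pi\<^sub>M J M)"
    unfolding h_def by measurable
  have Ef: "(\<integral>x. f x \<partial>Pi\<^sub>M (insert i J) M) = (\<integral>x. h x \<partial>Pi\<^sub>M J M)"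
    unfolding h_def using insert.hyps int_f by (intro product_integral_insert)
  define m where "m = (\<integral>x. h x \<partial>Pi\<^sub>M J M)"
  have h_diff: "\<bar>h (x(j := a)) - h x\<bar> \<le> c j"
    if j: "j \<in> J" "x \<in> space (Pi\<^sub>M J M)" "a \<in> space (M j)" for j x a
  proof -
    have xj: "x(j := a) \<in> space (Pi\<^sub>M J M)"
      using j by (auto simp: space_PiM PiE_iff extensional_def)
    have le: "\<bar>f (x(j := a, i := y)) - f (x(i := y))\<bar> \<le> c j" if y: "y \<in> space (M i)" for y
    proof -
      have "x(j := a, i := y) = (x(i := y))(j := a)" using insert.hyps(2) j(1) by (auto simp: fun_upd_twist)
      then show ?thesis by (simp only:) (rule insert.prems(2)[OF insertI2[OF j(1)] upd[OF j(2) y] j(3)])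
    qed
    have "\<bar>h (x(j := a)) - h x\<bar> = \<bar>\<integral>y. f (x(j := a, i := y)) - f (x(i := y)) \<partial>M i\<bar>"
      unfolding h_def using int_sect[OF xj] int_sect[OF j(2)] by simp
    also have "\<dots> \<le> (\<integral>y. \<bar>f (x(j := a, i := y)) - f (x(i := y))\<bar> \<partial>M i)"
      by (rule integral_abs_bound)
    also have "\<dots> \<le> (\<integral>y. c j \<partial>M i)"
      using le int_sect[OF xj] int_sect[OF j(2)] by (intro integral_mono) auto
    finally show ?thesis by (simp add: Mi.prob_space)
  qed
  have inner: "(\<integral>\<^sup>+y. exp (l * (f (x(i := y)) - h x)) \<partial>M i) \<le> exp (l\<^sup>2 * (c i)\<^sup>2 / 8)"
    if x: "x \<in> space (Pi\<^sub>M J M)" for x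
  proof -
    \<comment> \<open>Measured from its infimum, the section stays in an interval of length
      \<open>c i\<close> rather than \<open>2 * c i\<close>; this gives the constant 8 in the
      exponent.\<close>
    define a where "a = (INF y\<in>space (M i). f (x(i := y)))"
    have bdd: "bdd_below ((\<lambda>y. f (x(i := y))) ` space (M i))"
      using B[OF upd[OF x]] by (intro bdd_belowI2[where m = "-B"]) (auto simp: abs_le_iff minus_le_iff)
    have lo: "a \<le> f (x(i := y))" if "y \<in> space (M i)" for y
      unfolding a_def using bdd that by (rule cINF_lower)
    have hi: "f (x(i := y)) \<le> a + c i" if y: "y \<in> space (M i)" for y
    proof -
      have "f (x(i := y)) - c i \<le> a"
        unfolding a_def
      proof (rule cINF_greatest)
        fix y' assume y': "y' \<in> space (M i)"
        show "f (x(i := y)) - c i \<le> f (x(i := y'))"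
        proof -
          have "\<bar>f (x(i := y', i := y)) - f (x(i := y'))\<bar> \<le> c i"
            by (rule insert.prems(2)[OF insertI1 upd[OF x y'] y])
          then show ?thesis by (simp only: fun_upd_upd)
        qed
      qed (rule Mi.not_empty)
      then show ?thesis by simp
    qed
    interpret bv: interval_bounded_random_variable "M i" "\<lambda>y. f (x(i := y))" a "a + c i"
      using lo hi x by unfold_locales auto
    show ?thesis
      using bv.Hoeffdings_lemma_nn_integral[OF l] by (simp add: h_def)
  qed
  have "(\<integral>\<^sup>+x. exp (l * (f x - m)) \<partial>Pi\<^sub>M (insert i J) M)
      = (\<integral>\<^sup>+x. (\<integral>\<^sup>+y. exp (l * (f (x(i := y)) - m)) \<partial>M i) \<partial>Pi\<^sub>M J M)"
    using insert.hyps by (intro product_nn_integral_insert) auto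
  \<comment> \<open>The term \<open>h x - m\<close> is constant in \<open>y\<close>, so its
    exponential leaves the inner integral.\<close>
  also have "\<dots> = (\<integral>\<^sup>+x. exp (l * (h x - m)) * (\<integral>\<^sup>+y. exp (l * (f (x(i := y)) - h x)) \<partial>M i) \<partial>Pi\<^sub>M J M)"
    by (intro nn_integral_cong, subst nn_integral_cmult[symmetric])
      (auto simp: algebra_simps simp flip: ennreal_mult exp_add intro!: nn_integral_cong)
  also have "\<dots> \<le> (\<integral>\<^sup>+x. exp (l * (h x - m)) * ennreal (exp (l\<^sup>2 * (c i)\<^sup>2 / 8)) \<partial>Pi\<^sub>M J M)"
    by (intro nn_integral_mono mult_left_mono inner) auto
  also have "\<dots> = (\<integral>\<^sup>+x. exp (l * (h x - m)) \<partial>Pi\<^sub>M J M) * exp (l\<^sup>2 * (c i)\<^sup>2 / 8)"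
    by (intro nn_integral_multc) measurable
  also have "\<dots> \<le> ennreal (exp (l\<^sup>2 * (\<Sum>j\<in>J. (c j)\<^sup>2) / 8)) * exp (l\<^sup>2 * (c i)\<^sup>2 / 8)"
    unfolding m_def by (intro mult_right_mono insert.IH h h_diff) auto
  also have "\<dots> = exp (l\<^sup>2 * (\<Sum>j\<in>insert i J. (c j)\<^sup>2) / 8)"
    using insert.hyps by (simp add: algebra_simps add_divide_distrib flip: ennreal_mult exp_add)
  finally show ?case by (simp add: Ef m_def)
qed

section \<open>Product kernels and a tail bound\<close>

text \<open>Boxes form an intersection-stable generator of the product sigma-algebra, and the mass
  of a box is a finite product of measurable functions of the parameter. This makes the law of the
  model sample depend measurably on \<open>g\<close>.\<close>

lemma measurable_PiM_prob_algebra: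
  assumes "finite I" and K: "\<And>i. i \<in> I \<Longrightarrow> K i \<in> M \<rightarrow>\<^sub>M prob_algebra (N i)"
  shows "(\<lambda>x. \<Pi>\<^sub>M i\<in>I. K i x) \<in> M \<rightarrow>\<^sub>M prob_algebra (Pi\<^sub>M I N)"
proof (rule measurable_prob_algebra_generated)
  have Kx: "prob_space (K i x)" "sets (K i x) = sets (N i)" if "i \<in> I" "x \<in> space M" for i x
    using measurable_space[OF K that(2)] that(1) by (auto simp: space_prob_algebra)
  show "sets (Pi\<^sub>M I N) = sigma_sets (\<Pi>\<^sub>E i\<in>I. space (N i)) (prod_algebra I N)"
    by (rule sets_PiM)
  show "Int_stable (prod_algebra I N)" by (rule Int_stable_prod_algebra)
  show "prod_algebra I N \<subseteq> Pow (\<Pi>\<^sub>E i\<in>I. space (N i))" by (rule prod_algebra_sets_into_space)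
  show "prob_space (\<Pi>\<^sub>M i\<in>I. K i x)" if "x \<in> space M" for x
    using Kx that by (intro prob_space_PiM)
  show "sets (\<Pi>\<^sub>M i\<in>I. K i x) = sets (Pi\<^sub>M I N)" if "x \<in> space M" for x
    using Kx that by (intro sets_PiM_cong) auto
  fix A assume "A \<in> prod_algebra I N"
  then obtain X where A: "A = (\<Pi>\<^sub>E i\<in>I. X i)" and X: "\<And>i. i \<in> I \<Longrightarrow> X i \<in> sets (N i)"
    using assms(1) by (auto simp: prod_algebra_eq_finite)
  have "emeasure (\<Pi>\<^sub>M i\<in>I. K i x) A = (\<Prod>i\<in>I. emeasure (K i x) (X i))" if x: "x \<in> space M" for x
  proof -
    have X': "X i \<in> sets (K i x)" if "i \<in> I" for i using X Kx(2)[OF that x] that by simp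
    then have "A = prod_emb I (\<lambda>i. K i x) I (Pi\<^sub>E I X)"
      unfolding A by (intro prod_emb_PiE_same_index[symmetric] sets.sets_into_space)
    then show ?thesis using assms(1) Kx x X' by (simp add: emeasure_PiM_emb)
  qed
  moreover have "(\<lambda>x. \<Prod>i\<in>I. emeasure (K i x) (X i)) \<in> borel_measurable M"
    using measurable_emeasure_kernel[OF measurable_prob_algebraD[OF K] X]
    by (intro borel_measurable_prod_ennreal)
  ultimately show "(\<lambda>x. emeasure (\<Pi>\<^sub>M i\<in>I. K i x) A) \<in> borel_measurable M"
    by (simp cong: measurable_cong)
qed

text \<open>Markov's inequality for the complementary event. \<open>u\<close> is extended-valued
  because for (i) it is itself an integral over \<open>g\<close>, possibly infinite.\<close>

lemma (in prob_space) prob_le_inverse_ge: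
  assumes [measurable]: "u \<in> borel_measurable M" and "(\<integral>\<^sup>+x. u x \<partial>M) \<le> 1" "\<delta> > 0"
  shows "prob {x \<in> space M. u x \<le> ennreal (1 / \<delta>)} \<ge> 1 - \<delta>"
proof -
  have "emeasure M {x \<in> space M. \<not> u x \<le> ennreal (1 / \<delta>)}
      \<le> emeasure M {x \<in> space M. 1 \<le> ennreal \<delta> * u x}"
  proof (intro emeasure_mono)
    show "{x \<in> space M. \<not> u x \<le> ennreal (1 / \<delta>)} \<subseteq> {x \<in> space M. 1 \<le> ennreal \<delta> * u x}"
    proof safe
      fix x assume "x \<in> space M" "\<not> u x \<le> ennreal (1 / \<delta>)"
      then have "ennreal \<delta> * ennreal (1 / \<delta>) \<le> ennreal \<delta> * u x"
        by (intro mult_left_mono) auto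
      then show "1 \<le> ennreal \<delta> * u x" using \<open>\<delta> > 0\<close> by (simp flip: ennreal_mult)
    qed
  qed measurable
  also have "\<dots> \<le> ennreal \<delta> * (\<integral>\<^sup>+x. u x * indicator (space M) x \<partial>M)"
    by (rule nn_integral_Markov_inequality) auto
  also have "\<dots> = ennreal \<delta> * (\<integral>\<^sup>+x. u x \<partial>M)"
    by (auto intro!: nn_integral_cong arg_cong[where f = "\<lambda>x. ennreal \<delta> * x"])
  also have "\<dots> \<le> ennreal \<delta>" using mult_left_mono[OF assms(2), of "ennreal \<delta>"] by simp
  finally have "prob {x \<in> space M. \<not> u x \<le> ennreal (1 / \<delta>)} \<le> \<delta>"
    using \<open>\<delta> > 0\<close> by (simp add: emeasure_eq_measure)
  then show ?thesis using prob_neg[of "\<lambda>x. u x \<le> ennreal (1 / \<delta>)"] by simp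
qed

section \<open>The metric between empirical measures and the empirical risk\<close>

lemma ipm_triangle: "ipm F P Q \<le> ipm F P R + ipm F R Q"
  unfolding ipm_def[of F P Q]
proof (rule SUP_least)
  fix f assume f: "f \<in> F"
  have "ennreal \<bar>(\<integral>x. f x \<partial>P) - (\<integral>x. f x \<partial>Q)\<bar>
      \<le> ennreal \<bar>(\<integral>x. f x \<partial>P) - (\<integral>x. f x \<partial>R)\<bar> + ennreal \<bar>(\<integral>x. f x \<partial>R) - (\<integral>x. f x \<partial>Q)\<bar>"
    by (simp flip: ennreal_plus)
  also have "\<dots> \<le> ipm F P R + ipm F R Q"
    unfolding ipm_def using f by (intro add_mono SUP_upper)
  finally show "ennreal \<bar>(\<integral>x. f x \<partial>P) - (\<integral>x. f x \<partial>Q)\<bar> \<le> ipm F P R + ipm F R Q" .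
qed

text \<open>Pairing \<open>x i\<close> with \<open>y i\<close> couples the two empirical measures,
  and no 1-Lipschitz function separates them by more than the transport cost of this
  coupling.\<close>

lemma ipm_empirical_le:
  fixes F :: "('x::metric_space \<Rightarrow> real) set"
  assumes "n > 0" "F \<subseteq> Lip1"
  shows "ipm F (empirical n x) (empirical n y) \<le> ennreal ((\<Sum>i<n. dist (x i) (y i)) / real n)"
  unfolding ipm_def
proof (rule SUP_least)
  fix f assume "f \<in> F"
  with assms have lip: "1-lipschitz_on UNIV f" by (auto simp: Lip1_def)
  then have m: "f \<in> borel_measurable borel"
    by (intro borel_measurable_continuous_onI lipschitz_on_continuous_on)
  have "\<bar>\<Sum>i<n. f (x i) - f (y i)\<bar> \<le> (\<Sum>i<n. dist (x i) (y i))"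
    using lip by (intro order_trans[OF sum_abs] sum_mono) (auto simp: lipschitz_on_def dist_real_def)
  then show "ennreal \<bar>(\<integral>z. f z \<partial>empirical n x) - (\<integral>z. f z \<partial>empirical n y)\<bar>
        \<le> ennreal ((\<Sum>i<n. dist (x i) (y i)) / real n)"
    using m assms(1)
    by (intro ennreal_leI)
      (simp add: integral_empirical divide_right_mono sum_subtractf flip: diff_divide_distrib)
qed

lemma enn2real_ipm_empirical_le:
  fixes F :: "('x::metric_space \<Rightarrow> real) set"
  assumes "n > 0" "F \<subseteq> Lip1"
  shows "enn2real (ipm F (empirical n x) (empirical n y)) \<le> (\<Sum>i<n. dist (x i) (y i)) / real n"
  using ipm_empirical_le[OF assms, of x y] by (intro enn2real_leI) (auto intro!: sum_nonneg divide_nonneg_nonneg)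

lemma enn2real_ipm_empirical_triangle:
  fixes F :: "('x::metric_space \<Rightarrow> real) set"
  assumes "n > 0" "F \<subseteq> Lip1"
  shows "enn2real (ipm F (empirical n x) (empirical n z))
    \<le> (\<Sum>i<n. dist (x i) (y i)) / real n + enn2real (ipm F (empirical n y) (empirical n z))"
proof -
  let ?d = "\<lambda>x y. ipm F (empirical n x) (empirical n y)"
  have fin: "?d x y < top" for x y using ipm_empirical_finite[OF assms] by simp
  \<comment> \<open>Finiteness matters: \<open>enn2real\<close> sends infinity to 0 and is monotone
    and additive only on finite values.\<close>
  have "enn2real (?d x z) \<le> enn2real (?d x y + ?d y z)"
    using ipm_triangle fin by (intro enn2real_mono) auto
  also have "\<dots> = enn2real (?d x y) + enn2real (?d y z)"
    using fin by (intro enn2real_plus) auto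
  finally show ?thesis using enn2real_ipm_empirical_le[OF assms, of x y] by simp
qed

text \<open>The model sample lies almost surely in a bounded set, so its transport cost to the fixed
  \<open>x\<close> is bounded. The points of \<open>x\<close> may lie anywhere, hence the detour
  through the centre \<open>a\<close> of a ball.\<close>

lemma integrable_ipm_empirical:
  fixes F :: "('x::metric_space \<Rightarrow> real) set"
  assumes n: "n > 0" and F: "F \<subseteq> Lip1" and Q: "prob_space Q"
    and C: "bounded C" "AE y in Q. y \<in> C"
    and meas: "(\<lambda>y. ipm F (empirical n x) (empirical n y)) \<in> borel_measurable (iid_sample n Q)"
  shows "integrable (iid_sample n Q) (\<lambda>y. enn2real (ipm F (empirical n x) (empirical n y)))"
proof -
  interpret prob_space "iid_sample n Q" by (rule prob_space_PiM) (rule Q)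
  obtain a r where r: "C \<subseteq> cball a r" using C(1) by (auto simp: bounded_subset_cball)
  have AE: "AE y in iid_sample n Q. \<forall>i\<in>{..<n}. y i \<in> C"
    by (intro AE_finite_allI AE_PiM_component Q C) auto
  show ?thesis
  proof (rule integrable_const_bound[where B = "(\<Sum>i<n. dist (x i) a + r) / real n"])
    show "AE y in iid_sample n Q. norm (enn2real (ipm F (empirical n x) (empirical n y)))
        \<le> (\<Sum>i<n. dist (x i) a + r) / real n"
      using AE
    proof eventually_elim
      case (elim y)
      then have "dist (x i) (y i) \<le> dist (x i) a + r" if "i < n" for i
        using that r dist_triangle[of "x i" "y i" a] by fastforce
      then have "(\<Sum>i<n. dist (x i) (y i)) / real n \<le> (\<Sum>i<n. dist (x i) a + r) / real n"
        by (intro divide_right_mono sum_mono) auto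
      then show ?case using enn2real_ipm_empirical_le[OF n F, of x y] by simp
    qed
  qed (use meas in measurable)
qed

text \<open>The triangle inequality, integrated over the model sample in both directions.
  Integrability is assumed because the Bochner integral of a non-integrable function is 0, which
  would break monotonicity.\<close>

lemma empirical_risk_diff_le:
  fixes F :: "('x::metric_space \<Rightarrow> real) set"
  assumes n: "n > 0" and F: "F \<subseteq> Lip1" and Q: "prob_space Q"
    and int: "integrable (iid_sample n Q) (\<lambda>y. enn2real (ipm F (empirical n x) (empirical n y)))"
      "integrable (iid_sample n Q) (\<lambda>y. enn2real (ipm F (empirical n x') (empirical n y)))"
  shows "\<bar>empirical_risk F n x Q - empirical_risk F n x' Q\<bar> \<le> (\<Sum>i<n. dist (x i) (x' i)) / real n"
proof -
  interpret prob_space "iid_sample n Q" by (rule prob_space_PiM) (rule Q)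
  have le: "empirical_risk F n x Q \<le> (\<Sum>i<n. dist (x i) (x' i)) / real n + empirical_risk F n x' Q"
    if "integrable (iid_sample n Q) (\<lambda>y. enn2real (ipm F (empirical n x) (empirical n y)))"
      "integrable (iid_sample n Q) (\<lambda>y. enn2real (ipm F (empirical n x') (empirical n y)))" for x x'
  proof -
    have "empirical_risk F n x Q \<le> (\<integral>y. (\<Sum>i<n. dist (x i) (x' i)) / real n
        + enn2real (ipm F (empirical n x') (empirical n y)) \<partial>iid_sample n Q)"
      unfolding empirical_risk_def using that
      by (intro integral_mono enn2real_ipm_empirical_triangle n F) auto
    also have "\<dots> = (\<Sum>i<n. dist (x i) (x' i)) / real n + empirical_risk F n x' Q"
      unfolding empirical_risk_def using that by (simp add: prob_space)
    finally show ?thesis .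
  qed
  show ?thesis using le[OF int] le[OF int(2,1)] by (simp add: abs_le_iff dist_commute)
qed

text \<open>Integration against a kernel in the extended nonnegative reals is jointly measurable,
  and the risk is the image of such an integral under \<open>enn2real\<close>.\<close>

lemma measurable_empirical_risk:
  fixes F :: "('x::metric_space \<Rightarrow> real) set"
  assumes Q: "Q \<in> M \<rightarrow>\<^sub>M prob_algebra borel"
    and meas: "(\<lambda>(x, y). ipm F (empirical n x) (empirical n y))
          \<in> borel_measurable (iid_sample n borel \<Otimes>\<^sub>M iid_sample n borel)"
  shows "(\<lambda>(x, g). empirical_risk F n x (Q g)) \<in> borel_measurable (iid_sample n borel \<Otimes>\<^sub>M M)"
proof -
  let ?k = "\<lambda>x y. enn2real (ipm F (empirical n x) (empirical n y))"
  note [measurable] = meas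
  have ker: "(\<lambda>g. iid_sample n (Q g)) \<in> M \<rightarrow>\<^sub>M prob_algebra (iid_sample n borel)"
    using Q by (intro measurable_PiM_prob_algebra) auto
  have ker': "(\<lambda>p. iid_sample n (Q (snd p))) \<in> iid_sample n borel \<Otimes>\<^sub>M M \<rightarrow>\<^sub>M subprob_algebra (iid_sample n borel)"
    using measurable_compose[OF measurable_snd measurable_prob_algebraD[OF ker]] .
  have "(\<lambda>p. enn2real (\<integral>\<^sup>+y. ?k (fst p) y \<partial>iid_sample n (Q (snd p))))
      \<in> borel_measurable (iid_sample n borel \<Otimes>\<^sub>M M)"
    by (intro measurable_compose[OF nn_integral_measurable_subprob_algebra2[OF _ ker']]) measurable
  \<comment> \<open>This holds even where the nonnegative integral is infinite: both sides are then
    0.\<close>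
  moreover have "empirical_risk F n x (Q g) = enn2real (\<integral>\<^sup>+y. ?k x y \<partial>iid_sample n (Q g))"
    if x: "x \<in> space (iid_sample n borel)" and g: "g \<in> space M" for x g
  proof -
    have [measurable_cong]: "sets (iid_sample n (Q g)) = sets (iid_sample n borel)"
      using measurable_space[OF ker g] by (simp add: space_prob_algebra)
    have "?k x \<in> borel_measurable (iid_sample n (Q g))" using x by measurable
    then show ?thesis unfolding empirical_risk_def by (intro integral_eq_nn_integral) auto
  qed
  ultimately show ?thesis
    by (subst measurable_cong[where g = "\<lambda>p. enn2real (\<integral>\<^sup>+y. ?k (fst p) y \<partial>iid_sample n (Q (snd p)))"])
      (auto simp: space_pair_measure)
qed

section \<open>Change of measure and Jensen's inequality\<close>

text \<open>The integrand is the reciprocal of dN/dM. Writing \<open>N\<close> as this density times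
  \<open>M\<close> cancels it and leaves the \<open>M\<close>-mass of the set where the density is
  positive.\<close>

lemma nn_integral_exp_minus_entropy_density_le:
  assumes "prob_space M" "prob_space N" "absolutely_continuous M N" "sets N = sets M"
  shows "(\<integral>\<^sup>+x. exp (- entropy_density (exp 1) M N x) \<partial>N) \<le> 1"
proof -
  interpret M: prob_space M by fact
  interpret N: prob_space N by fact
  note [measurable_cong] = assms(4)
  have "density M (RN_deriv M N) = N"
    using assms(3,4) by (rule M.density_RN_deriv)
  then have "(\<integral>\<^sup>+x. exp (- entropy_density (exp 1) M N x) \<partial>N)
      = (\<integral>\<^sup>+x. exp (- entropy_density (exp 1) M N x) \<partial>density M (RN_deriv M N))"
    by simp
  also have "\<dots> = (\<integral>\<^sup>+x. RN_deriv M N x * exp (- entropy_density (exp 1) M N x) \<partial>M)"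
    by (intro nn_integral_density) auto
  also have "\<dots> \<le> (\<integral>\<^sup>+x. 1 \<partial>M)"
  proof (rule nn_integral_mono_AE)
    have "AE x in M. RN_deriv M N x \<noteq> \<infinity>"
      using assms(3,4) N.sigma_finite_measure_axioms by (intro M.RN_deriv_finite)
    then show "AE x in M. RN_deriv M N x * exp (- entropy_density (exp 1) M N x) \<le> 1"
    proof eventually_elim
      case (elim x)
      then obtain r where r: "RN_deriv M N x = ennreal r" "r \<ge> 0"
        by (cases "RN_deriv M N x") auto
      \<comment> \<open>Where the density is 0 the product is 0, whatever the logarithm is there;
        elsewhere it is exactly 1.\<close>
      then show ?case
        by (cases "r = 0") (auto simp: entropy_density_def log_def exp_minus simp flip: ennreal_mult)
    qed
  qed
  finally show ?thesis by (simp add: M.emeasure_space_1)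
qed

text \<open>Jensen's inequality for the exponential, by its tangent line: integrate 1 + (f - c)
  \<le> exp (f - c), whose right-hand side has mean at most 1.\<close>

lemma (in prob_space) integral_le_of_nn_integral_exp_le:
  assumes f: "integrable M f" and le: "(\<integral>\<^sup>+x. exp (f x) \<partial>M) \<le> ennreal (exp c)"
  shows "(\<integral>x. f x \<partial>M) \<le> c"
proof -
  have [measurable]: "f \<in> borel_measurable M" using f by auto
  have "(\<integral>\<^sup>+x. exp (f x) \<partial>M) < \<infinity>" using le by (simp add: order_le_less_trans)
  then have int: "integrable M (\<lambda>x. exp (f x))" by (intro integrableI_nonneg) auto
  have "ennreal (\<integral>x. exp (f x) \<partial>M) \<le> ennreal (exp c)"
    using le nn_integral_eq_integral[OF int] by simp
  then have "exp (- c) * (\<integral>x. exp (f x) \<partial>M) \<le> 1" by (simp add: exp_minus field_simps)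
  moreover have "(\<integral>x. f x \<partial>M) \<le> (\<integral>x. exp (- c) * exp (f x) + (c - 1) \<partial>M)"
  proof (rule integral_mono)
    show "f x \<le> exp (- c) * exp (f x) + (c - 1)" for x
      using exp_ge_add_one_self[of "f x - c"] by (simp add: exp_diff exp_minus field_simps)
  qed (use f int in auto)
  moreover have "(\<integral>x. exp (- c) * exp (f x) + (c - 1) \<partial>M) = exp (- c) * (\<integral>x. exp (f x) \<partial>M) + (c - 1)"
    using int by (simp add: prob_space)
  ultimately show ?thesis by simp
qed

text \<open>Jensen's inequality for minus the log-density, with \<open>c = 0\<close>. It settles the
  degenerate case of (i) in which the risk is not integrable over the posterior.\<close>

lemma KL_nonneg:
  assumes "prob_space \<pi>" "prob_space \<rho>" "absolutely_continuous \<pi> \<rho>" "sets \<rho> = sets \<pi>"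
  shows "KL \<rho> \<pi> \<ge> 0"
proof (cases "integrable \<rho> (entropy_density (exp 1) \<pi> \<rho>)")
  case True
  then have "(\<integral>x. - entropy_density (exp 1) \<pi> \<rho> x \<partial>\<rho>) \<le> 0"
    using nn_integral_exp_minus_entropy_density_le[OF assms]
    by (intro prob_space.integral_le_of_nn_integral_exp_le assms) auto
  then show ?thesis using True by (simp add: KL_def KL_divergence_def)
qed (simp add: KL_def)

section \<open>Lipschitz images of the unit cube\<close>

lemma unit_cube_eq_cbox: "unit_cube = cbox 0 (1 :: real ^ 'd)"
  by (auto simp: unit_cube_def mem_box_cart)

lemma dist_unit_cube_le:
  fixes z z' :: "real ^ 'd"
  assumes "z \<in> unit_cube" "z' \<in> unit_cube"
  shows "dist z z' \<le> sqrt (real CARD('d))"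
proof -
  have "dist (z $ i) (z' $ i) \<le> 1" for i
    using assms by (auto simp: unit_cube_def dist_real_def abs_le_iff intro: add_increasing2 dest!: spec[of _ i])
  then have "(\<Sum>i\<in>UNIV. (dist (z $ i) (z' $ i))\<^sup>2) \<le> (\<Sum>i\<in>(UNIV :: 'd set). 1)"
    by (intro sum_mono) (simp add: abs_square_le_1)
  then show ?thesis by (simp add: dist_vec_def L2_set_def)
qed

lemma lipschitz_image_unit_cube_dist_le:
  fixes g :: "real ^ 'd \<Rightarrow> 'x::metric_space"
  assumes "K-lipschitz_on unit_cube g" "x \<in> g ` unit_cube" "x' \<in> g ` unit_cube"
  shows "dist x x' \<le> K * sqrt (real CARD('d))"
proof -
  obtain z z' where z: "z \<in> unit_cube" "z' \<in> unit_cube" "x = g z" "x' = g z'" using assms(2,3) by auto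
  then have "dist x x' \<le> K * dist z z'" using assms(1) by (auto simp: lipschitz_on_def)
  also have "\<dots> \<le> K * sqrt (real CARD('d))"
    using z assms(1) by (intro mult_left_mono dist_unit_cube_le) (auto simp: lipschitz_on_def)
  finally show ?thesis .
qed

lemma lipschitz_unit_cube_measurable:
  fixes g :: "real ^ 'd \<Rightarrow> 'x::metric_space"
  assumes "K-lipschitz_on unit_cube g" "sets M = sets (restrict_space borel unit_cube)"
  shows "g \<in> M \<rightarrow>\<^sub>M borel"
  unfolding measurable_cong_sets[OF assms(2) refl]
  using lipschitz_on_continuous_on[OF assms(1)] by (rule borel_measurable_continuous_on_restrict)

text \<open>Compactness makes the image closed and hence Borel, which the image of a measurable set
  need not be.\<close>

lemma AE_distr_in_compact_image:
  fixes g :: "'a \<Rightarrow> 'x::metric_space"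
  assumes "g \<in> M \<rightarrow>\<^sub>M borel" "compact (g ` space M)"
  shows "AE y in distr M borel g. y \<in> g ` space M"
proof -
  have "g ` space M \<in> sets borel" using assms(2) by (intro borel_closed compact_imp_closed)
  then show ?thesis by (subst AE_distr_iff[OF assms(1)]) auto
qed

text \<open>The sample is pulled back to the cube. There the differences are bounded at every point,
  as \<open>bounded_differences_exp\<close> demands, whereas on the target space they are controlled
  only almost surely.\<close>

lemma exp_mean_deviation_lipschitz_sample_le:
  fixes g :: "real ^ 'd \<Rightarrow> 'x::metric_space" and h :: "(nat \<Rightarrow> 'x) \<Rightarrow> real"
  assumes n: "n > 0" and P: "prob_space P" "sets P = sets (restrict_space borel unit_cube)"
    and g: "K-lipschitz_on unit_cube g"
    and h: "h \<in> borel_measurable (iid_sample n borel)"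
    and h_lip: "\<And>x x'. x \<in> space (iid_sample n (borel :: 'x measure)) \<Longrightarrow> x' \<in> space (iid_sample n (borel :: 'x measure))
      \<Longrightarrow> \<bar>h x - h x'\<bar> \<le> (\<Sum>i<n. dist (x i) (x' i)) / real n"
    and l: "l > 0"
  shows "(\<integral>\<^sup>+x. exp (l * ((\<integral>s. h s \<partial>iid_sample n (distr P borel g)) - h x)) \<partial>iid_sample n (distr P borel g))
    \<le> exp (l\<^sup>2 * K\<^sup>2 * real CARD('d) / (8 * real n))"
proof -
  define Q where "Q = distr P borel g"
  \<comment> \<open>\<open>compose\<close> restricts to \<open>{..<n}\<close>, so that
    \<open>T\<close> maps into extensional functions, the points of the product space.\<close>
  define T where "T = compose {..<n} g"
  have space_P: "space P = unit_cube"
    using sets_eq_imp_space_eq[OF P(2)] by (simp add: space_restrict_space)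
  have gm [measurable]: "g \<in> P \<rightarrow>\<^sub>M borel"
    using g P(2) by (rule lipschitz_unit_cube_measurable)
  have Q: "prob_space Q" unfolding Q_def by (intro prob_space.prob_space_distr P gm)
  have Qs [measurable_cong]: "sets Q = sets borel" by (simp add: Q_def)
  have Tm [measurable]: "T \<in> iid_sample n P \<rightarrow>\<^sub>M iid_sample n Q"
    unfolding T_def compose_def by measurable
  have hm [measurable]: "h \<in> borel_measurable (iid_sample n Q)"
    using h by (simp cong: measurable_cong_sets sets_PiM_cong add: Qs)
  have distr: "iid_sample n Q = distr (iid_sample n P) (iid_sample n Q) T"
    using distr_PiM_finite_prob_space'[of "{..<n}" "\<lambda>_. P" "\<lambda>_. Q" g] P(1) Q
    by (simp add: T_def Q_def cong: distr_cong)
  \<comment> \<open>The sign is reversed because the deviation of \<open>h\<close> below its mean is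
    wanted.\<close>
  define f where "f z = - h (T z)" for z
  have fm: "f \<in> borel_measurable (iid_sample n P)" unfolding f_def by measurable
  have Ef: "(\<integral>z. f z \<partial>iid_sample n P) = - (\<integral>s. h s \<partial>iid_sample n Q)"
    unfolding f_def by (subst distr) (simp add: integral_distr)
  have f_diff: "\<bar>f (z(i := a)) - f z\<bar> \<le> K * sqrt (real CARD('d)) / real n"
    if i: "i \<in> {..<n}" and z: "z \<in> space (iid_sample n P)" and a: "a \<in> space P" for i z a
  proof -
    have zi: "z i \<in> unit_cube" using z i space_P by (auto simp: space_PiM)
    have "\<bar>f (z(i := a)) - f z\<bar> = \<bar>h (T (z(i := a))) - h (T z)\<bar>"
      unfolding f_def by simp
    also have "\<dots> \<le> (\<Sum>j<n. dist (T (z(i := a)) j) (T z j)) / real n"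
      by (intro h_lip) (auto simp: T_def space_PiM compose_def)
    also have "(\<Sum>j<n. dist (T (z(i := a)) j) (T z j)) = (\<Sum>j<n. if j = i then dist (g a) (g (z i)) else 0)"
      by (intro sum.cong) (auto simp: T_def compose_def)
    also have "\<dots> = dist (g a) (g (z i))" using i by simp
    also have "dist (g a) (g (z i)) / real n \<le> K * sqrt (real CARD('d)) / real n"
      using zi a space_P by (intro divide_right_mono lipschitz_image_unit_cube_dist_le[OF g]) auto
    finally show ?thesis .
  qed
  have "(\<integral>\<^sup>+x. exp (l * ((\<integral>s. h s \<partial>iid_sample n Q) - h x)) \<partial>iid_sample n Q)
      = (\<integral>\<^sup>+z. exp (l * (f z - (\<integral>z. f z \<partial>iid_sample n P))) \<partial>iid_sample n P)"
    unfolding Ef by (subst (1) distr) (simp add: nn_integral_distr f_def)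
  also have "\<dots> \<le> exp (l\<^sup>2 * (\<Sum>i<n. (K * sqrt (real CARD('d)) / real n)\<^sup>2) / 8)"
    by (intro bounded_differences_exp P fm f_diff l) auto
  \<comment> \<open>The \<open>n\<close> equal squares K^2 d / n^2 add up to K^2 d / n.\<close>
  also have "l\<^sup>2 * (\<Sum>i<n. (K * sqrt (real CARD('d)) / real n)\<^sup>2) / 8
      = l\<^sup>2 * K\<^sup>2 * real CARD('d) / (8 * real n)"
    using n by (simp add: power_mult_distrib power_divide power2_eq_square[of "real n"])
  finally show ?thesis unfolding Q_def .
qed

section \<open>PAC-Bayes bounds, averaged over the posterior and for a single draw from it\<close>

theorem theorem3p4:
  fixes F :: "('x::metric_space \<Rightarrow> real) set"
    and Pstar :: "'x measure"
    and PZ :: "(real ^ 'd::finite) measure"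
    and gstar :: "real ^ 'd \<Rightarrow> 'x"
    and G :: "(real ^ 'd \<Rightarrow> 'x) set"
    and MG \<pi> \<rho> :: "(real ^ 'd \<Rightarrow> 'x) measure"
    and n :: nat
    and K l \<delta> :: real
  assumes F: "F \<subseteq> Lip1" "symmetric_class F"
    and n: "n \<ge> 1"
    and PZ: "prob_space PZ" "sets PZ = sets (restrict_space borel unit_cube)"
    and Pstar: "prob_space Pstar" "Pstar = distr PZ borel gstar"
    and K: "K > 0" "\<And>g. g \<in> G \<union> {gstar} \<Longrightarrow> K-lipschitz_on unit_cube g"
    and MG: "space MG = G"
    and kernel: "(\<lambda>g. distr PZ borel g) \<in> MG \<rightarrow>\<^sub>M prob_algebra borel"
    and ipm_measurable: "(\<lambda>(x, y). ipm F (empirical n x) (empirical n y))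
          \<in> borel_measurable (iid_sample n borel \<Otimes>\<^sub>M iid_sample n borel)"
    and prior: "prob_space \<pi>" "sets \<pi> = sets MG"
    and l: "l > 0"
    and \<delta>: "0 < \<delta>" "\<delta> < 1"
    and posterior: "prob_space \<rho>" "sets \<rho> = sets MG"
    and ac: "absolutely_continuous \<pi> \<rho>" "absolutely_continuous \<rho> \<pi>"
  defines "W \<equiv> \<lambda>x g. empirical_risk F n x (distr PZ borel g)"
  shows "\<P>(x in iid_sample n Pstar.
            ereal ((\<integral>g. (\<integral>s. W s g \<partial>iid_sample n Pstar) \<partial>\<rho>) - (\<integral>g. W x g \<partial>\<rho>))
              \<le> ereal (1 / l) * (KL \<rho> \<pi> + ereal (ln (1 / \<delta>)))
                + ereal (l * K\<^sup>2 * real CARD('d) / (4 * real n))) \<ge> 1 - \<delta>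
       \<and> \<P>((x, g) in iid_sample n Pstar \<Otimes>\<^sub>M \<rho>.
            (\<integral>s. W s g \<partial>iid_sample n Pstar) - W x g
              \<le> 1 / l * (ln (enn2real (RN_deriv \<pi> \<rho> g)) + ln (1 / \<delta>))
                + l * K\<^sup>2 * real CARD('d) / (4 * real n)) \<ge> 1 - \<delta>"
proof -
  define S where "S = iid_sample n Pstar"
  interpret S: prob_space S unfolding S_def by (rule prob_space_PiM) (rule Pstar)
  interpret R: prob_space \<rho> by (rule posterior)
  interpret P: pair_prob_space S \<rho> by unfold_locales
  have n0: "n > 0" using n by simp
  have S_sets [measurable_cong]: "sets S = sets (iid_sample n borel)"
    unfolding S_def using Pstar(2) by (intro sets_PiM_cong) auto
  note S_space = sets_eq_imp_space_eq[OF S_sets]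
  note [measurable_cong] = posterior(2) prior(2)
  have \<rho>_space: "space \<rho> = G" using sets_eq_imp_space_eq[OF posterior(2)] MG by simp
  have PZ_space: "space PZ = unit_cube"
    using sets_eq_imp_space_eq[OF PZ(2)] by (simp add: space_restrict_space)
  have g_meas: "g \<in> PZ \<rightarrow>\<^sub>M borel" if "g \<in> G \<union> {gstar}" for g
    using K(2)[OF that] PZ(2) by (rule lipschitz_unit_cube_measurable)
  have g_compact: "compact (g ` unit_cube)" if "g \<in> G \<union> {gstar}" for g
    using lipschitz_on_continuous_on[OF K(2)[OF that]]
    by (intro compact_continuous_image) (auto simp: unit_cube_eq_cbox)
  have g_AE: "AE y in distr PZ borel g. y \<in> g ` unit_cube" if "g \<in> G \<union> {gstar}" for g
    using AE_distr_in_compact_image[of g PZ] g_meas[OF that] g_compact[OF that] by (simp add: PZ_space)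
  \<comment> \<open>The law induced by \<open>g\<close> lives on a compact image of the cube, so the
    integrability required by \<open>empirical_risk_diff_le\<close> holds for every sample
    \<open>x\<close>.\<close>
  have W_lip: "\<bar>W x g - W x' g\<bar> \<le> (\<Sum>i<n. dist (x i) (x' i)) / real n"
    if g: "g \<in> G" and x: "x \<in> space (iid_sample n (borel :: 'x measure))"
      "x' \<in> space (iid_sample n (borel :: 'x measure))" for x x' g
  proof -
    have Q: "prob_space (distr PZ borel g)" using g by (intro prob_space.prob_space_distr PZ g_meas) auto
    have "integrable (iid_sample n (distr PZ borel g)) (\<lambda>y. enn2real (ipm F (empirical n x) (empirical n y)))"
      if x: "x \<in> space (iid_sample n (borel :: 'x measure))" for x
    proof (rule integrable_ipm_empirical[OF n0 F(1) Q])
      show "bounded (g ` unit_cube)" "AE y in distr PZ borel g. y \<in> g ` unit_cube"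
        using g g_compact g_AE by (auto intro: compact_imp_bounded)
      have "sets (iid_sample n (distr PZ borel g)) = sets (iid_sample n (borel :: 'x measure))"
        by (intro sets_PiM_cong) auto
      then show "(\<lambda>y. ipm F (empirical n x) (empirical n y)) \<in> borel_measurable (iid_sample n (distr PZ borel g))"
        using measurable_compose[OF measurable_Pair1'[OF x] ipm_measurable]
        by (simp cong: measurable_cong_sets)
    qed
    then show ?thesis unfolding W_def using x by (intro empirical_risk_diff_le n0 F Q)
  qed
  have W_meas [measurable]: "(\<lambda>(x, g). W x g) \<in> borel_measurable (S \<Otimes>\<^sub>M \<rho>)"
    using measurable_empirical_risk[OF kernel ipm_measurable] unfolding W_def by measurable
  have W_meas1 [measurable]: "(\<lambda>x. W x g) \<in> borel_measurable S" if "g \<in> G" for g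
    using measurable_compose[OF measurable_Pair2'[of g \<rho> S] W_meas] that \<rho>_space by simp
  have W_meas2 [measurable]: "W x \<in> borel_measurable \<rho>" if "x \<in> space S" for x
    using measurable_compose[OF measurable_Pair1'[OF that] W_meas] by simp
  define EW where "EW g = (\<integral>s. W s g \<partial>S)" for g
  have EW_meas [measurable]: "EW \<in> borel_measurable \<rho>"
    unfolding EW_def by measurable
  \<comment> \<open>\<open>C\<close> bounds the diameter of the image of the cube under
    \<open>gstar\<close>. It serves integrability only; the exponential estimate uses the finer
    bound C / n per coordinate.\<close>
  define C where "C = K * sqrt (real CARD('d))"
  have W_diff: "\<bar>W x g - W x' g\<bar> \<le> C"
    if "g \<in> G" "x \<in> space S" "x' \<in> space S"
      "\<forall>i\<in>{..<n}. x i \<in> gstar ` unit_cube" "\<forall>i\<in>{..<n}. x' i \<in> gstar ` unit_cube" for x x' g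
  proof -
    have "(\<Sum>i<n. dist (x i) (x' i)) \<le> (\<Sum>i<n. C)"
      unfolding C_def using that K(2) by (intro sum_mono lipschitz_image_unit_cube_dist_le[of K gstar]) auto
    then have "(\<Sum>i<n. dist (x i) (x' i)) / real n \<le> C" using n0 by (simp add: field_simps)
    then show ?thesis using W_lip[of g x x'] that S_space by simp
  qed
  have supp: "AE x in S. \<forall>i\<in>{..<n}. x i \<in> gstar ` unit_cube"
    unfolding S_def using g_AE[of gstar] Pstar
    by (intro AE_finite_allI AE_PiM_component) auto
  \<comment> \<open>The bound is uniform in \<open>g\<close>, so the deviation is \<rho>-integrable
    even if \<open>W x\<close> is not.\<close>
  have dev: "\<bar>EW g - W x g\<bar> \<le> C"
    if g: "g \<in> G" and x: "x \<in> space S" "\<forall>i\<in>{..<n}. x i \<in> gstar ` unit_cube" for x g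
  proof -
    have AE: "AE s in S. \<bar>W s g - W x g\<bar> \<le> C"
      using supp AE_space by eventually_elim (use W_diff g x in auto)
    have int: "integrable S (\<lambda>s. W s g - W x g)"
      using AE g by (intro S.integrable_const_bound[where B = C]) auto
    \<comment> \<open>Adding back the constant \<open>W x g\<close> shows that \<open>W s g\<close>
      is integrable in \<open>s\<close>, so the integral of the difference may be split.\<close>
    have "integrable S (\<lambda>s. (W s g - W x g) + W x g)" using int by (intro Bochner_Integration.integrable_add) auto
    then have "EW g - W x g = (\<integral>s. W s g - W x g \<partial>S)" by (simp add: EW_def S.prob_space)
    also have "\<bar>\<dots>\<bar> \<le> (\<integral>s. \<bar>W s g - W x g\<bar> \<partial>S)" by (rule integral_abs_bound)
    also have "\<dots> \<le> (\<integral>s. C \<partial>S)" using int AE by (intro integral_mono_AE) auto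
    finally show ?thesis by (simp add: S.prob_space)
  qed
  define c where "c = l\<^sup>2 * K\<^sup>2 * real CARD('d) / (8 * real n)"
  define r where "r = entropy_density (exp 1) \<pi> \<rho>"
  have r_eq: "r g = ln (enn2real (RN_deriv \<pi> \<rho> g))" for g
    by (simp add: r_def entropy_density_def log_def)
  have r_meas [measurable]: "r \<in> borel_measurable \<rho>"
    using measurable_entropy_density[of "exp 1" \<pi> \<rho>] posterior(2) prior(2)
    unfolding r_def by (simp cong: measurable_cong_sets)
  \<comment> \<open>The normalisation is chosen so that exp \<psi> has mean at most 1 on the product
    space: \<open>c\<close> absorbs the exponential moment over \<open>S\<close>, and
    \<open>r\<close> leaves the reciprocal density to be integrated over \<rho>.\<close>
  define \<psi> where "\<psi> x g = l * (EW g - W x g) - c - r g" for x g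
  have \<psi>_meas [measurable]: "(\<lambda>(x, g). \<psi> x g) \<in> borel_measurable (S \<Otimes>\<^sub>M \<rho>)"
    unfolding \<psi>_def by measurable
  have inner: "(\<integral>\<^sup>+x. exp (\<psi> x g) \<partial>S) \<le> exp (- r g)" if g: "g \<in> G" for g
  proof -
    have "(\<integral>\<^sup>+x. exp (l * (EW g - W x g)) \<partial>S) \<le> exp c"
      unfolding S_def EW_def c_def Pstar(2)
      using K(2) W_lip[OF g] W_meas1[OF g] S_sets
      by (intro exp_mean_deviation_lipschitz_sample_le n0 PZ l) (auto cong: measurable_cong_sets)
    then have "(\<integral>\<^sup>+x. exp (l * (EW g - W x g)) \<partial>S) * ennreal (exp (- c - r g)) \<le> ennreal (exp c) * ennreal (exp (- c - r g))"
      by (intro mult_right_mono) auto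
    moreover have "(\<integral>\<^sup>+x. exp (\<psi> x g) \<partial>S) = (\<integral>\<^sup>+x. exp (l * (EW g - W x g)) \<partial>S) * ennreal (exp (- c - r g))"
      using g by (subst nn_integral_multc[symmetric])
        (auto simp: \<psi>_def algebra_simps simp flip: ennreal_mult exp_add)
    ultimately show ?thesis by (simp flip: ennreal_mult exp_add)
  qed
  define u where "u x = (\<integral>\<^sup>+g. exp (\<psi> x g) \<partial>\<rho>)" for x
  have u_meas [measurable]: "u \<in> borel_measurable S" unfolding u_def by measurable
  have u_le: "(\<integral>\<^sup>+x. u x \<partial>S) \<le> 1"
  proof -
    have "(\<integral>\<^sup>+x. u x \<partial>S) = (\<integral>\<^sup>+g. (\<integral>\<^sup>+x. exp (\<psi> x g) \<partial>S) \<partial>\<rho>)"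
      unfolding u_def by (rule P.Fubini'[symmetric]) measurable
    also have "\<dots> \<le> (\<integral>\<^sup>+g. exp (- r g) \<partial>\<rho>)"
      using inner \<rho>_space by (intro nn_integral_mono) auto
    also have "\<dots> \<le> 1"
      unfolding r_def using prior posterior ac
      by (intro nn_integral_exp_minus_entropy_density_le) auto
    finally show ?thesis .
  qed
  \<comment> \<open>The term \<open>c / l\<close> is half of the claimed one.\<close>
  have c_l: "c / l \<le> l * K\<^sup>2 * real CARD('d) / (4 * real n)"
    using l n0 K(1) by (simp add: c_def field_simps power2_eq_square)
  have ln_\<delta>: "exp (ln (1 / \<delta>)) = 1 / \<delta>" "ln (1 / \<delta>) \<ge> 0" using \<delta> by auto
  \<comment> \<open>Solves \<psi> \<le> log (1/\<delta>) for the deviation \<open>e\<close>;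
    \<open>k\<close> is the log-density in (ii) and its \<rho>-mean in (i).\<close>
  have bound: "e \<le> 1 / l * (k + ln (1 / \<delta>)) + l * K\<^sup>2 * real CARD('d) / (4 * real n)"
    if "l * e - c - k \<le> ln (1 / \<delta>)" for e k
  proof -
    have "e \<le> 1 / l * (k + ln (1 / \<delta>)) + c / l" using that l by (simp add: field_simps)
    then show ?thesis using c_l by linarith
  qed
  have joint: "1 - \<delta> \<le> measure (S \<Otimes>\<^sub>M \<rho>) {p \<in> space (S \<Otimes>\<^sub>M \<rho>). case p of (x, g) \<Rightarrow>
      EW g - W x g \<le> 1 / l * (ln (enn2real (RN_deriv \<pi> \<rho> g)) + ln (1 / \<delta>))
                + l * K\<^sup>2 * real CARD('d) / (4 * real n)}"
  proof -
    have "(\<integral>\<^sup>+p. exp (\<psi> (fst p) (snd p)) \<partial>(S \<Otimes>\<^sub>M \<rho>)) \<le> 1"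
      using u_le by (subst R.nn_integral_fst[symmetric]) (auto simp: u_def)
    then have "1 - \<delta> \<le> measure (S \<Otimes>\<^sub>M \<rho>)
        {p \<in> space (S \<Otimes>\<^sub>M \<rho>). ennreal (exp (\<psi> (fst p) (snd p))) \<le> ennreal (1 / \<delta>)}"
      using \<delta> by (intro P.prob_le_inverse_ge) auto
    also have "\<dots> \<le> measure (S \<Otimes>\<^sub>M \<rho>) {p \<in> space (S \<Otimes>\<^sub>M \<rho>). case p of (x, g) \<Rightarrow>
      EW g - W x g \<le> 1 / l * (r g + ln (1 / \<delta>)) + l * K\<^sup>2 * real CARD('d) / (4 * real n)}"
    proof (rule P.finite_measure_mono)
      show "{p \<in> space (S \<Otimes>\<^sub>M \<rho>). ennreal (exp (\<psi> (fst p) (snd p))) \<le> ennreal (1 / \<delta>)}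
        \<subseteq> {p \<in> space (S \<Otimes>\<^sub>M \<rho>). case p of (x, g) \<Rightarrow>
            EW g - W x g \<le> 1 / l * (r g + ln (1 / \<delta>)) + l * K\<^sup>2 * real CARD('d) / (4 * real n)}"
      proof safe
        fix x g assume "ennreal (exp (\<psi> (fst (x, g)) (snd (x, g)))) \<le> ennreal (1 / \<delta>)"
        then have "exp (\<psi> x g) \<le> exp (ln (1 / \<delta>))" using ln_\<delta> \<delta> by simp
        then have "\<psi> x g \<le> ln (1 / \<delta>)" by (simp only: exp_le_cancel_iff)
        then show "EW g - W x g \<le> 1 / l * (r g + ln (1 / \<delta>)) + l * K\<^sup>2 * real CARD('d) / (4 * real n)"
          unfolding \<psi>_def by (rule bound)
      qed
    qed measurable
    finally show ?thesis by (simp add: r_eq)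
  qed
  have marginal: "1 - \<delta> \<le> measure S {x \<in> space S. ereal ((\<integral>g. EW g \<partial>\<rho>) - (\<integral>g. W x g \<partial>\<rho>))
              \<le> ereal (1 / l) * (KL \<rho> \<pi> + ereal (ln (1 / \<delta>)))
                + ereal (l * K\<^sup>2 * real CARD('d) / (4 * real n))}" (is "_ \<le> measure S {x \<in> space S. ?A x}")
  proof -
    have "1 - \<delta> \<le> measure S {x \<in> space S. u x \<le> ennreal (1 / \<delta>)}"
      using u_le \<delta> by (intro S.prob_le_inverse_ge) auto
    also have "\<dots> \<le> measure S {x \<in> space S. ?A x}"
    proof (rule S.finite_measure_mono_AE)
      \<comment> \<open>The inclusion of events holds only up to a null set, since
        \<open>dev\<close> needs all sample points in the image of \<open>gstar\<close>.\<close>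
      have ev: "?A x" if x: "x \<in> space S" "\<forall>i\<in>{..<n}. x i \<in> gstar ` unit_cube"
        and u: "u x \<le> ennreal (1 / \<delta>)" for x
      proof (cases "integrable \<rho> r")
        case False
        \<comment> \<open>Here the divergence is infinite and the claim trivial.\<close>
        then show ?thesis using l by (simp add: KL_def r_def)
      next
        case int_r: True
        then have KL: "KL \<rho> \<pi> = ereal (\<integral>g. r g \<partial>\<rho>)" by (simp add: KL_def r_def KL_divergence_def)
        have int_D: "integrable \<rho> (\<lambda>g. EW g - W x g)"
          using dev x \<rho>_space by (intro R.integrable_const_bound[where B = C]) auto
        have "(\<integral>g. EW g \<partial>\<rho>) - (\<integral>g. W x g \<partial>\<rho>)
            \<le> 1 / l * ((\<integral>g. r g \<partial>\<rho>) + ln (1 / \<delta>)) + l * K\<^sup>2 * real CARD('d) / (4 * real n)"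
        proof (cases "integrable \<rho> (W x)")
          case True
          \<comment> \<open>\<open>EW\<close> inherits integrability from \<open>W x\<close> through
            the bounded deviation, so the mean of \<psi> splits into the terms of the claim.\<close>
          have "integrable \<rho> (\<lambda>g. (EW g - W x g) + W x g)" using int_D True by (rule Bochner_Integration.integrable_add)
          then have int_EW: "integrable \<rho> EW" by simp
          have "(\<integral>g. \<psi> x g \<partial>\<rho>) \<le> ln (1 / \<delta>)"
          proof (rule R.integral_le_of_nn_integral_exp_le)
            show "integrable \<rho> (\<psi> x)" unfolding \<psi>_def using int_D int_r by auto
            show "(\<integral>\<^sup>+g. exp (\<psi> x g) \<partial>\<rho>) \<le> ennreal (exp (ln (1 / \<delta>)))"
              using u ln_\<delta> by (simp add: u_def)
          qed
          moreover have "(\<integral>g. \<psi> x g \<partial>\<rho>) = l * ((\<integral>g. EW g \<partial>\<rho>) - (\<integral>g. W x g \<partial>\<rho>)) - c - (\<integral>g. r g \<partial>\<rho>)"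
            unfolding \<psi>_def using int_EW True int_r by (simp add: R.prob_space)
          ultimately show ?thesis by (intro bound) simp
        next
          case False
          txt \<open>Both outer integrals then have the junk value 0, because their integrands differ by a
            bounded function.\<close>
          have "\<not> integrable \<rho> EW"
          proof
            assume "integrable \<rho> EW"
            then have "integrable \<rho> (\<lambda>g. EW g - (EW g - W x g))" using int_D by (rule Bochner_Integration.integrable_diff)
            then show False using False by simp
          qed
          then have "(\<integral>g. EW g \<partial>\<rho>) - (\<integral>g. W x g \<partial>\<rho>) = 0"
            using False by (simp add: not_integrable_integral_eq)
          \<comment> \<open>With left-hand side 0 it remains to see that the right-hand side is
            nonnegative; nonnegativity of the divergence is the nontrivial part.\<close>
          moreover have "(\<integral>g. r g \<partial>\<rho>) \<ge> 0"
            using KL_nonneg[of \<pi> \<rho>] KL prior posterior ac by simp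
          then have "1 / l * ((\<integral>g. r g \<partial>\<rho>) + ln (1 / \<delta>)) + l * K\<^sup>2 * real CARD('d) / (4 * real n) \<ge> 0"
            using l ln_\<delta> by (intro add_nonneg_nonneg mult_nonneg_nonneg) auto
          ultimately show ?thesis by simp
        qed
        then show ?thesis by (simp add: KL)
      qed
      show "AE x in S. x \<in> {x \<in> space S. u x \<le> ennreal (1 / \<delta>)} \<longrightarrow> x \<in> {x \<in> space S. ?A x}"
        using supp by eventually_elim (blast intro: ev)
    qed measurable
    finally show ?thesis .
  qed
  show ?thesis using marginal joint unfolding EW_def S_def by (simp only: case_prod_unfold prod.collapse)
qed

end
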